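(* Let $k$ be a positive integer, $n$ a non-negative integer, and $p$ a prime with $p\equiv 3\pmod 4$. Let $\delta$ be a non-negative integer with $p\mid 4\delta+3$. Put $$N_1=p\,(4p^kn+4\delta+3),\qquad N_2=4p^{k-1}n+\frac{4\delta+3}{p}.$$ Then $\mathcal{J}_{10}(N_1)\equiv\mathcal{J}_{10}(N_2)\pmod 2$.
   Context: Let $q=e^{2\pi i\tau}$, $(a;q)_\infty=\prod_{j\ge0}(1-aq^j)$, and $\eta(\tau)=q^{1/24}(q;q)_\infty$. Define $$j_{10}(\tau)=\frac{\eta(2\tau)\eta(5\tau)^5}{\eta(\tau)\eta(10\tau)^5}-1=\frac1q+\sum_{n\ge0}\mathcal{J}_{10}(n)q^n.$$ *)

theory Defs
  imports "HOL-Computational_Algebra.Computational_Algebra" "HOL-Number_Theory.Number_Theory"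
begin

text \<open>The q-Pochhammer product (q^m;q^m)_infinity = prod_{j>=1} (1 - q^(m j)) as an integer
  formal power series: its n-th coefficient is the n-th coefficient of the finite product
  over j = 1..n (the factors with j > n do not affect it).\<close>
definition qpoch_inf :: "nat \<Rightarrow> int fps" where
  "qpoch_inf m = Abs_fps (\<lambda>n. (\<Prod>j\<in>{1..n}. (1 - fps_X ^ (m * j) :: int fps)) $ n)"

text \<open>F(q) = (q^2;q^2)(q^5;q^5)^5 / ((q;q)(q^10;q^10)^5); then
  j10 = q^(-1) F(q) - 1, so J10(n) is the (n+1)-st coefficient of F minus [n = 0].\<close>
definition j10_F :: "int fps" where
  "j10_F = qpoch_inf 2 * qpoch_inf 5 ^ 5 *
           fps_right_inverse (qpoch_inf 1 * qpoch_inf 10 ^ 5) 1"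

definition J10 :: "nat \<Rightarrow> int" where
  "J10 n = j10_F $ (n + 1) - (if n = 0 then 1 else 0)"

end

(*
  Write f_m for (q^m;q^m)_infinity modulo 2, so that f_(2m) = f_m^2 and F = q (j10 + 1) = f_1 / f_5^5.
  The triple product gives f_m^3 = sum q^(m n (n+1)/2) and f_1 f_5 = f(q,q^4) f(q^2,q^3).
  The coefficient of q^r in the latter counts the ideals of Z[i] of norm 4r+1 that are prime to
  1 - 2i, and complex conjugation shows that it is odd iff exactly one of "4r+1 is a square" and
  "4r+1 is five times a square" holds.  In other words f_1 f_5 = f_1^6 + q f_5^6.  Two dissections
  with this identity show that J10(4r+1) has the parity of the coefficient of q^r in f_1 f_5.
  Finally N_1 = p^2 N_2 with N_2 = 1 (mod 4), and multiplying by p^2 changes neither condition.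
*)
theory Submission
  imports Defs "HOL-Library.Z2"
begin

section \<open>Truncated equality and Euler products\<close>

text \<open>The denominator of f_1 / f_5^5 keeps theta series from describing its coefficients
  directly. Modulo 2 a squared denominator is a series in q^2 and does not disturb a split by the
  parity of exponents, so it is enough to split the numerator of (f_1 f_5) / f_5^6. The identity for
  f_1 f_5 does that, because its right side is a square plus q times a square. The even part is (f_1
  / f_5)^6. Its square root (f_1 / f_5)^3 = f_1^2 (f_1 f_5) / f_5^4 again has numerator f_1 f_5 up
  to squares, and now the odd part is q (f_1 f_5)^2, free of denominators.\<close>

definition fps_eq_upto :: "nat \<Rightarrow> 'a fps \<Rightarrow> 'a fps \<Rightarrow> bool" where
  "fps_eq_upto n f g \<longleftrightarrow> (\<forall>i\<le>n. fps_nth f i = fps_nth g i)"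

lemma fps_eq_upto_refl [simp]: "fps_eq_upto n f f"
  by (simp add: fps_eq_upto_def)

lemma fps_eq_upto_sym: "fps_eq_upto n f g \<Longrightarrow> fps_eq_upto n g f"
  by (simp add: fps_eq_upto_def)

lemma fps_eq_upto_trans [trans]:
  "fps_eq_upto n f g \<Longrightarrow> fps_eq_upto n g h \<Longrightarrow> fps_eq_upto n f h"
  by (simp add: fps_eq_upto_def)

lemma fps_eq_upto_mono: "fps_eq_upto n f g \<Longrightarrow> m \<le> n \<Longrightarrow> fps_eq_upto m f g"
  by (simp add: fps_eq_upto_def)

lemma fps_eqI_upto: "(\<And>n. fps_eq_upto n f g) \<Longrightarrow> f = g"
  by (auto simp: fps_eq_upto_def fps_eq_iff)

lemma fps_eq_upto_mult:
  fixes f g :: "'a :: comm_semiring_1 fps"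
  assumes "fps_eq_upto n f f'" "fps_eq_upto n g g'"
  shows "fps_eq_upto n (f * g) (f' * g')"
  using assms by (auto simp: fps_eq_upto_def fps_mult_nth intro!: sum.cong)

lemma fps_eq_upto_power:
  fixes f :: "'a :: comm_semiring_1 fps"
  shows "fps_eq_upto n f g \<Longrightarrow> fps_eq_upto n (f ^ k) (g ^ k)"
  by (induction k) (auto intro: fps_eq_upto_mult)

lemma fps_eq_upto_sum:
  "(\<And>x. x \<in> A \<Longrightarrow> fps_eq_upto n (f x) (g x)) \<Longrightarrow> fps_eq_upto n (sum f A) (sum g A)"
  by (auto simp: fps_eq_upto_def fps_sum_nth intro!: sum.cong)

text \<open>The gain of \<open>e\<close> orders carries the triple product: its terms far from the
  centre are accurate only to low order, but contain a high power of \<open>fps_X\<close>.\<close>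

lemma fps_eq_upto_X_power_mult:
  fixes f :: "'a :: comm_semiring_1 fps"
  assumes "fps_eq_upto n f g"
  shows "fps_eq_upto (n + e) (fps_X ^ e * f) (fps_X ^ e * g)"
  using assms by (auto simp: fps_eq_upto_def fps_X_power_mult_nth)

lemma fps_eq_upto_cancel:
  fixes f :: "'a :: comm_ring_1 fps"
  assumes "fps_eq_upto n (f * g) (f * h)" "fps_nth f 0 = 1"
  shows "fps_eq_upto n g h"
proof -
  define r where "r = fps_right_inverse f 1"
  have r: "f * r = 1" unfolding r_def using assms(2) by (intro fps_right_inverse) simp
  have "fps_eq_upto n (r * (f * g)) (r * (f * h))"
    by (intro fps_eq_upto_mult assms(1)) simp
  thus ?thesis using r by (simp add: mult.assoc[symmetric] mult.commute[of r])
qed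

definition euler_prod :: "nat \<Rightarrow> nat \<Rightarrow> 'a :: comm_ring_1 fps" where
  "euler_prod m N = (\<Prod>j\<in>{1..N}. 1 - fps_X ^ (m * j))"

text \<open>Stopping at factor \<open>n\<close> mirrors \<open>qpoch_inf\<close>, but over any
  commutative ring, so that the same series exists over the integers and over the field with two
  elements.\<close>

definition euler_fps :: "nat \<Rightarrow> 'a :: comm_ring_1 fps" where
  "euler_fps m = Abs_fps (\<lambda>n. fps_nth (euler_prod m n) n)"

lemma euler_prod_Suc: "euler_prod m (Suc n) = euler_prod m n * (1 - fps_X ^ (m * Suc n))"
  by (simp add: euler_prod_def mult.commute)

lemma euler_prod_eq_upto_aux:
  assumes "m > 0" "n \<le> N"
  shows "fps_eq_upto n (euler_prod m n :: 'a :: comm_ring_1 fps) (euler_prod m N)"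
  using assms(2)
proof (induction N rule: dec_induct)
  case (step N)
  have "fps_eq_upto n (1 :: 'a fps) (1 - fps_X ^ (m * Suc N))"
    unfolding fps_eq_upto_def
  proof safe
    fix i assume "i \<le> n"
    hence "i < Suc N" using step.hyps by simp
    also have "Suc N \<le> m * Suc N" using mult_le_mono1[of 1 m "Suc N"] assms(1) by simp
    finally have "i < m * Suc N" .
    thus "fps_nth (1 :: 'a fps) i = fps_nth (1 - fps_X ^ (m * Suc N)) i" by simp
  qed
  from fps_eq_upto_mult[OF step.IH this] show ?case
    by (simp add: euler_prod_def prod.atLeast1_atMost_eq)
qed simp

lemma euler_prod_eq_upto:
  assumes "m > 0" "n \<le> M" "n \<le> N"
  shows "fps_eq_upto n (euler_prod m M :: 'a :: comm_ring_1 fps) (euler_prod m N)"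
  using euler_prod_eq_upto_aux[OF assms(1,2)] euler_prod_eq_upto_aux[OF assms(1,3)]
  by (meson fps_eq_upto_sym fps_eq_upto_trans)

lemma euler_fps_eq_upto:
  assumes "m > 0" "n \<le> N"
  shows "fps_eq_upto n (euler_fps m :: 'a :: comm_ring_1 fps) (euler_prod m N)"
  unfolding fps_eq_upto_def euler_fps_def fps_nth_Abs_fps
proof safe
  fix i assume "i \<le> n"
  hence "fps_eq_upto i (euler_prod m i :: 'a fps) (euler_prod m N)"
    using assms by (intro euler_prod_eq_upto_aux) auto
  thus "fps_nth (euler_prod m i :: 'a fps) i = fps_nth (euler_prod m N) i"
    by (simp add: fps_eq_upto_def)
qed

lemma euler_prod_nth_0: "m > 0 \<Longrightarrow> fps_nth (euler_prod m N) 0 = 1"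
  by (induction N) (auto simp: euler_prod_def)

lemma euler_fps_nth_0: "m > 0 \<Longrightarrow> fps_nth (euler_fps m) 0 = 1"
  by (simp add: euler_fps_def euler_prod_nth_0)

section \<open>The Jacobi triple product\<close>

fun qbinom :: "'a :: comm_ring_1 \<Rightarrow> nat \<Rightarrow> nat \<Rightarrow> 'a" where
  "qbinom q n 0 = 1"
| "qbinom q 0 (Suc k) = 0"
| "qbinom q (Suc n) (Suc k) = qbinom q n k + q ^ Suc k * qbinom q n (Suc k)"

lemma qbinom_eq_0: "n < k \<Longrightarrow> qbinom q n k = 0"
proof (induction n arbitrary: k)
  case 0 thus ?case by (cases k) auto
next
  case (Suc n) thus ?case by (cases k) auto
qed

lemma qbinom_self: "qbinom q n n = 1"
  by (induction n) (auto simp: qbinom_eq_0)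

text \<open>The homogeneous form avoids negative powers of \<open>q\<close>: the shift that the
  triple product needs is absorbed by \<open>y\<close>.\<close>

lemma qbinom_theorem:
  fixes x y q :: "'a :: comm_ring_1"
  shows "(\<Prod>j<n. y + x * q ^ j) =
         (\<Sum>k\<le>n. q ^ (k choose 2) * qbinom q n k * x ^ k * y ^ (n - k))"
proof (induction n arbitrary: x)
  case (Suc n)
  have ch: "Suc k choose 2 = (k choose 2) + k" for k
    by (simp add: numeral_2_eq_2)
  let ?c = "\<lambda>k. q ^ (k choose 2) * q ^ k * qbinom q n k * x ^ k"
  \<comment> \<open>Splitting off \<open>j = 0\<close> turns \<open>x\<close> into
    \<open>x * q\<close>, which is why the induction generalizes \<open>x\<close>.\<close>
  have "(\<Prod>j<Suc n. y + x * q ^ j) = (y + x) * (\<Prod>j<n. y + (x * q) * q ^ j)"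
    by (simp only: prod.lessThan_Suc_shift) (simp add: algebra_simps)
  also have "(\<Prod>j<n. y + (x * q) * q ^ j) = (\<Sum>k\<le>n. ?c k * y ^ (n - k))"
    by (subst Suc.IH) (simp add: power_mult_distrib algebra_simps)
  also have "(y + x) * \<dots> = (\<Sum>k\<le>n. ?c k * y ^ Suc (n - k)) + (\<Sum>k\<le>n. x * ?c k * y ^ (n - k))"
    by (simp add: algebra_simps sum_distrib_left sum.distrib)
  also have "(\<Sum>k\<le>n. ?c k * y ^ Suc (n - k)) = (\<Sum>k\<le>Suc n. ?c k * y ^ (Suc n - k))"
    by (simp add: qbinom_eq_0 Suc_diff_le)
  also have "\<dots> = y ^ Suc n + (\<Sum>k\<le>n. ?c (Suc k) * y ^ (n - k))"
    by (subst sum.atMost_Suc_shift) (simp add: numeral_2_eq_2)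
  also have "\<dots> + (\<Sum>k\<le>n. x * ?c k * y ^ (n - k)) =
     y ^ Suc n + (\<Sum>k\<le>n. q ^ (Suc k choose 2) * qbinom q (Suc n) (Suc k) * x ^ Suc k * y ^ (n - k))"
    by (simp add: add.assoc sum.distrib[symmetric] ch power_add algebra_simps)
  also have "\<dots> = (\<Sum>k\<le>Suc n. q ^ (k choose 2) * qbinom q (Suc n) k * x ^ k * y ^ (Suc n - k))"
    unfolding sum.atMost_Suc_shift[of _ n] by (simp add: numeral_2_eq_2)
  finally show ?case .
qed (simp add: numeral_2_eq_2)

text \<open>The quotient formula with denominators cleared, as the ring has no division. The
  induction rests on \<open>1 - q^(i+l) = (1 - q^i) + q^i * (1 - q^l)\<close>.\<close>

lemma qbinom_mult_qfact:
  fixes q :: "'a :: comm_ring_1"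
  assumes "k \<le> n"
  shows "qbinom q n k * (\<Prod>j\<in>{1..k}. 1 - q ^ j) * (\<Prod>j\<in>{1..n-k}. 1 - q ^ j) = (\<Prod>j\<in>{1..n}. 1 - q ^ j)"
proof -
  define P where "P n = (\<Prod>j\<in>{1..n}. 1 - q ^ j)" for n
  have P_0: "P 0 = 1" and P_Suc: "P (Suc i) = P i * (1 - q ^ Suc i)" for i
    by (simp_all add: P_def)
  have "qbinom q n k * P k * P (n - k) = P n" using assms
  proof (induction n arbitrary: k)
    case (Suc n)
    show ?case
    proof (cases k)
      case (Suc j)
      show ?thesis
      proof (cases "j = n")
        case True
        thus ?thesis by (simp add: Suc P_0 qbinom_self qbinom_eq_0)
      next
        case False
        hence jn: "j < n" using Suc.prems Suc by simp
        then obtain d where d: "n = j + Suc d" using less_iff_Suc_add by auto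
        have "qbinom q (Suc n) (Suc j) * P (Suc j) * P (Suc n - Suc j) =
          (qbinom q n j * P j * P (n - j)) * (1 - q ^ Suc j) +
          q ^ Suc j * (qbinom q n (Suc j) * P (Suc j) * P (n - Suc j)) * (1 - q ^ Suc d)"
          by (simp add: d P_Suc algebra_simps)
        also have "\<dots> = P n * (1 - q ^ Suc j) + q ^ Suc j * P n * (1 - q ^ Suc d)"
          using jn by (simp only: Suc.IH less_imp_le Suc_leI)
        also have "\<dots> = P (Suc n)"
          unfolding P_Suc by (simp add: d algebra_simps power_add)
        finally show ?thesis by (simp add: Suc)
      qed
    qed (simp add: P_0)
  qed (simp add: P_0)
  thus ?thesis by (simp add: P_def)
qed

text \<open>The sum over all integers \<open>k\<close> of \<open>q\<close> to the power
  \<open>a k (k + 1) / 2 + b k (k - 1) / 2\<close>, which is Ramanujan's theta function \<open>f(q^a, q^b)\<close>.\<close>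
definition theta_fps :: "nat \<Rightarrow> nat \<Rightarrow> 'a :: comm_ring_1 fps" where
  "theta_fps a b = Abs_fps (\<lambda>i. of_nat (card
     {k::int. int a * (k * (k + 1)) + int b * (k * (k - 1)) = 2 * int i}))"

text \<open>As \<open>j\<close> starts at 1, the subtractions are exact: the exponents are
  \<open>b + (a + b) * (j - 1)\<close> and \<open>a + (a + b) * (j - 1)\<close>.\<close>

definition theta_prod :: "nat \<Rightarrow> nat \<Rightarrow> nat \<Rightarrow> 'a :: comm_ring_1 fps" where
  "theta_prod a b n = (\<Prod>j\<in>{1..n}. (1 + fps_X ^ ((a + b) * j - a)) * (1 + fps_X ^ ((a + b) * j - b)))"

lemma theta_prod_Suc:
  "theta_prod a b (Suc n) = theta_prod a b n *
     ((1 + fps_X ^ ((a + b) * Suc n - a)) * (1 + fps_X ^ ((a + b) * Suc n - b)))"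
  by (simp add: theta_prod_def mult.commute)

definition theta_exp :: "nat \<Rightarrow> nat \<Rightarrow> int \<Rightarrow> nat" where
  "theta_exp a b k = nat ((int a * (k * (k + 1)) + int b * (k * (k - 1))) div 2)"

lemma consec_nonneg: "(k::int) * (k + 1) \<ge> 0" "(k::int) * (k - 1) \<ge> 0"
  by (auto simp: zero_le_mult_iff)

text \<open>Products of consecutive integers are even and nonnegative, so neither \<open>div\<close>
  nor \<open>nat\<close> loses anything.\<close>

lemma double_theta_exp: "2 * int (theta_exp a b k) = int a * (k * (k + 1)) + int b * (k * (k - 1))"
proof -
  have "even (int a * (k * (k + 1)) + int b * (k * (k - 1)))" by auto
  moreover have "int a * (k * (k + 1)) + int b * (k * (k - 1)) \<ge> 0"
    using consec_nonneg[of k] by simp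
  ultimately show ?thesis
    unfolding theta_exp_def 
    by (metis dvd_mult_div_cancel int_nat_eq pos_imp_zdiv_nonneg_iff zero_less_numeral)
qed

text \<open>This growth makes the fibres of \<open>theta_exp\<close> finite, makes all
  \<open>k\<close> beyond \<open>n\<close> invisible up to order \<open>n\<close>, and supplies the
  precision needed in the triple product.\<close>

lemma theta_exp_ge:
  assumes "a > 0" "b > 0"
  shows "\<bar>k\<bar> \<le> int (theta_exp a b k)"
proof -
  have "1 * (k * (k + 1)) \<le> int a * (k * (k + 1))" "1 * (k * (k - 1)) \<le> int b * (k * (k - 1))"
    by (rule mult_right_mono; use assms consec_nonneg[of k] in simp)+
  hence "2 * k\<^sup>2 \<le> 2 * int (theta_exp a b k)"
    unfolding double_theta_exp by (simp add: algebra_simps power2_eq_square)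
  moreover have "\<bar>k\<bar> \<le> k\<^sup>2"
  proof (cases "k = 0")
    case False
    hence "\<bar>k\<bar> * 1 \<le> \<bar>k\<bar> * \<bar>k\<bar>" by (intro mult_left_mono) auto
    thus ?thesis by (simp add: power2_eq_square)
  qed simp
  ultimately show ?thesis by simp
qed

lemma theta_set_eq:
  "{k::int. int a * (k * (k + 1)) + int b * (k * (k - 1)) = 2 * int i} = {k. theta_exp a b k = i}"
  by (auto simp flip: double_theta_exp)

lemma finite_theta_set:
  assumes "a > 0" "b > 0"
  shows "finite {k. theta_exp a b k = i}"
proof (rule finite_subset)
  show "{k. theta_exp a b k = i} \<subseteq> {- int i..int i}"
    using theta_exp_ge[OF assms] by (smt (verit) atLeastAtMost_iff mem_Collect_eq subsetI)
qed simp

text \<open>The q-binomial theorem with \<open>2 * n\<close> factors, recentred at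
  \<open>j = n\<close>: the factors below \<open>n\<close> yield one family of
  \<open>theta_prod\<close>, those from \<open>n\<close> on the other.\<close>

lemma theta_prod_finite_expansion:
  assumes "a > 0" "b > 0"
  shows "theta_prod a b n =
    (\<Sum>j\<le>2*n. qbinom (fps_X ^ (a + b)) (2 * n) j * fps_X ^ theta_exp a b (int j - int n) :: 'a :: idom fps)"
proof (cases "n = 0")
  case True
  thus ?thesis by (simp add: theta_prod_def theta_exp_def)
next
  case False
  define m where "m = a + b"
  define Q :: "'a fps" where "Q = fps_X ^ m"
  have mn: "m * j \<ge> a" "m * j \<ge> b" if "j > 0" for j
    using that by (cases j; simp add: m_def)+
  \<comment> \<open>Scaling the q-binomial theorem by this power of \<open>X\<close> avoids negative exponents.\<close>
  define s where "s = m * n - a"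
  have s: "int s = int m * int n - int a" using mn[of n] False by (simp add: s_def of_nat_diff)
  \<comment> \<open>\<open>c\<close> collects the exponents pulled out of the product:
    \<open>m * j\<close> from each factor with \<open>j < n\<close>, and \<open>s\<close> from each
    of the other \<open>n\<close> factors.\<close>
  define c where "c = m * (n choose 2) + n * s"
  have ch2: "2 * int (j choose 2) = int j * (int j - 1)" for j
  proof -
    have "2 * (j choose 2) = j * (j - 1)" unfolding choose_two by (intro dvd_mult_div_cancel) auto
    hence "int (2 * (j choose 2)) = int (j * (j - 1))" by (rule arg_cong)
    thus ?thesis by (cases j) (simp_all add: algebra_simps)
  qed
  have A: "(\<Prod>j<2*n. fps_X ^ s + 1 * Q ^ j) = fps_X ^ c * theta_prod a b n"
  proof -
    have split: "{..<2*n} = {..<n} \<union> {n..<2*n}" by auto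
    have "(\<Prod>j<2*n. fps_X ^ s + 1 * Q ^ j) =
      (\<Prod>j<n. fps_X ^ s + Q ^ j) * (\<Prod>j\<in>{n..<2*n}. fps_X ^ s + Q ^ j)"
      unfolding split by (subst prod.union_disjoint) auto
    also have "(\<Prod>j<n. fps_X ^ s + Q ^ j) = (\<Prod>j<n. Q ^ j * (1 + fps_X ^ (m * (n - j) - a)))"
    proof (rule prod.cong)
      fix j assume "j \<in> {..<n}"
      then obtain d where d: "n = j + d" "d > 0" by (metis lessThan_iff less_imp_add_positive)
      have "s = m * j + (m * (n - j) - a)"
        using mn(1)[of d] d by (simp add: s_def algebra_simps)
      hence "fps_X ^ s = Q ^ j * fps_X ^ (m * (n - j) - a)"
        by (simp only: Q_def power_mult power_add)
      thus "fps_X ^ s + Q ^ j = Q ^ j * (1 + fps_X ^ (m * (n - j) - a))"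
        by (simp add: distrib_left add.commute)
    qed simp
    also have "\<dots> = Q ^ (n choose 2) * (\<Prod>j<n. 1 + fps_X ^ (m * (n - j) - a))"
    proof -
      have "(\<Sum>j<n. j) = n choose 2" for n by (induction n) (simp_all add: numeral_2_eq_2)
      thus ?thesis by (simp add: prod.distrib flip: power_sum)
    qed
    also have "(\<Prod>j<n. 1 + fps_X ^ (m * (n - j) - a)) = (\<Prod>j\<in>{1..n}. 1 + fps_X ^ (m * j - a) :: 'a fps)"
      by (rule prod.reindex_bij_witness[of _ "\<lambda>j. n - j" "\<lambda>j. n - j"]) auto
    also have "(\<Prod>j\<in>{n..<2*n}. fps_X ^ s + Q ^ j) = (\<Prod>j\<in>{1..n}. fps_X ^ s * (1 + fps_X ^ (m * j - b)))"
    proof (rule prod.reindex_bij_witness[of _ "\<lambda>j. j + n - 1" "\<lambda>j. j + 1 - n"])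
      fix j assume "j \<in> {n..<2*n}"
      then obtain i where i: "j = n + i" by (auto simp: le_iff_add)
      have "m * j = s + (m * (j + 1 - n) - b)"
        using mn[of "i+1"] mn[of n] False unfolding i s_def 
        by (simp add: m_def algebra_simps)
      thus "fps_X ^ s * (1 + fps_X ^ (m * (j + 1 - n) - b)) = fps_X ^ s + Q ^ j"
        by (simp add: Q_def algebra_simps flip: power_mult power_add)
    qed auto
    also have "\<dots> = fps_X ^ (n * s) * (\<Prod>j\<in>{1..n}. 1 + fps_X ^ (m * j - b))"
      by (simp add: prod.distrib mult.commute flip: power_mult)
    finally show ?thesis
      unfolding theta_prod_def prod.distrib c_def Q_def power_add power_mult m_def[symmetric]
      by (simp only: mult_ac)
  qed
  have B: "Q ^ (j choose 2) * qbinom Q (2 * n) j * 1 ^ j * (fps_X ^ s) ^ (2 * n - j) =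
     fps_X ^ c * (qbinom Q (2 * n) j * fps_X ^ theta_exp a b (int j - int n))" if "j \<le> 2 * n" for j
  proof -
    have d: "int (2 * n - j) = 2 * int n - int j" using that by simp
    have "2 * int (m * (j choose 2) + s * (2 * n - j)) =
          int m * (2 * int (j choose 2)) + 2 * int s * (2 * int n - int j)"
      unfolding of_nat_add of_nat_mult d by (simp add: algebra_simps)
    also have "\<dots> = int m * (2 * int (n choose 2)) + 2 * int n * int s + 2 * int (theta_exp a b (int j - int n))"
      unfolding ch2 double_theta_exp s by (simp add: m_def algebra_simps)
    also have "\<dots> = 2 * int (c + theta_exp a b (int j - int n))"
      by (simp add: c_def algebra_simps)
    finally have "m * (j choose 2) + s * (2 * n - j) = c + theta_exp a b (int j - int n)"
      by (metis mult_cancel_left of_nat_eq_iff zero_neq_numeral)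
    hence "Q ^ (j choose 2) * (fps_X ^ s) ^ (2 * n - j) = fps_X ^ c * fps_X ^ theta_exp a b (int j - int n)"
      by (simp add: Q_def flip: power_mult power_add)
    thus ?thesis by (simp add: algebra_simps)
  qed
  have "fps_X ^ c * theta_prod a b n =
    fps_X ^ c * (\<Sum>j\<le>2*n. qbinom Q (2 * n) j * fps_X ^ theta_exp a b (int j - int n))"
    unfolding A[symmetric] qbinom_theorem sum_distrib_left by (intro sum.cong refl B) simp
  thus ?thesis by (simp add: Q_def m_def)
qed

lemma theta_sum_eq_upto:
  assumes "a > 0" "b > 0"
  shows "fps_eq_upto n (\<Sum>j\<le>2*n. fps_X ^ theta_exp a b (int j - int n)) (theta_fps a b)"
  unfolding fps_eq_upto_def
proof safe
  fix i assume i: "i \<le> n"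
  have bound: "\<bar>k\<bar> \<le> int n" if "theta_exp a b k = i" for k
    using theta_exp_ge[OF assms, of k] that i by simp
  have "bij_betw (\<lambda>j. int j - int n) {j\<in>{..2*n}. theta_exp a b (int j - int n) = i} {k. theta_exp a b k = i}"
  proof (rule bij_betw_byWitness[of _ "\<lambda>k. nat (k + int n)"], goal_cases)
    case 2
    show ?case using bound by force
  next
    case 4
    show ?case using bound by force
  qed auto
  hence "card {j\<in>{..2*n}. theta_exp a b (int j - int n) = i} = card {k. theta_exp a b k = i}"
    by (rule bij_betw_same_card)
  moreover have "(\<Sum>j\<le>2*n. fps_X ^ theta_exp a b (int j - int n)) $ i =
     (of_nat (card {j\<in>{..2*n}. theta_exp a b (int j - int n) = i}) :: 'a)"
    by (simp add: fps_sum_nth eq_commute[of i] sum.If_cases Int_def)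
  ultimately show "(\<Sum>j\<le>2*n. fps_X ^ theta_exp a b (int j - int n)) $ i = (theta_fps a b :: 'a fps) $ i"
    by (simp add: theta_fps_def theta_set_eq)
qed

text \<open>By the quotient formula, the Gaussian binomial times the Euler product is 1 up to order
  \<open>d = min j (2 * n - j)\<close>. The missing \<open>n - d = |j - n|\<close> orders come from
  the power of \<open>fps_X\<close> beside it.\<close>

theorem jacobi_triple_product_eq_upto:
  assumes "a > 0" "b > 0"
  shows "fps_eq_upto n (theta_prod a b n * euler_prod (a + b) n) (theta_fps a b :: 'a :: idom fps)"
proof -
  define m where "m = a + b"
  have m: "m > 0" using assms by (simp add: m_def)
  let ?E = "\<lambda>n. euler_prod m n :: 'a fps"
  let ?G = "qbinom (fps_X ^ m :: 'a fps) (2 * n)"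
  let ?e = "\<lambda>j. theta_exp a b (int j - int n)"
  have approx: "fps_eq_upto n (?G j * fps_X ^ ?e j * ?E n) (fps_X ^ ?e j)" if j: "j \<le> 2 * n" for j
  proof -
    define d where "d = min j (2 * n - j)"
    have le: "d \<le> j" "d \<le> 2 * n - j" "d \<le> n" "d \<le> 2 * n" using j by (auto simp: d_def)
    have G: "?G j * ?E j * ?E (2 * n - j) = ?E (2 * n)"
      using qbinom_mult_qfact[OF j, of "fps_X ^ m :: 'a fps"] by (simp add: euler_prod_def power_mult)
    have "fps_eq_upto d (?G j * ?E n * ?E (2 * n)) (?G j * ?E j * ?E (2 * n - j))"
      by (intro fps_eq_upto_mult fps_eq_upto_refl euler_prod_eq_upto m le)
    hence "fps_eq_upto d (?E (2 * n) * (?G j * ?E n)) (?E (2 * n) * 1)"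
      unfolding G by (simp add: mult_ac)
    hence "fps_eq_upto d (?G j * ?E n) 1"
      by (rule fps_eq_upto_cancel) (simp add: euler_prod_nth_0 m)
    hence "fps_eq_upto (d + ?e j) (fps_X ^ ?e j * (?G j * ?E n)) (fps_X ^ ?e j * 1)"
      by (rule fps_eq_upto_X_power_mult)
    moreover have "n \<le> d + ?e j"
      using theta_exp_ge[OF assms, of "int j - int n"] j by (auto simp: d_def min_def)
    ultimately show ?thesis by (auto simp: mult_ac elim: fps_eq_upto_mono)
  qed
  have "fps_eq_upto n (\<Sum>j\<le>2*n. ?G j * fps_X ^ ?e j * ?E n) (\<Sum>j\<le>2*n. fps_X ^ ?e j)"
    by (intro fps_eq_upto_sum approx) simp
  also have "fps_eq_upto n \<dots> (theta_fps a b)" by (rule theta_sum_eq_upto[OF assms])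
  finally show ?thesis
    by (simp add: theta_prod_finite_expansion[OF assms] m_def sum_distrib_right)
qed

section \<open>Power series over the field with two elements\<close>

lemma bit_fps_two [simp]: "(2 :: bit fps) = 0"
proof -
  have "(2 :: bit fps) = fps_const 2" by (rule fps_numeral_fps_const)
  thus ?thesis by simp
qed

lemma bit_fps_add_self [simp]: "(f :: bit fps) + f = 0"
  by (metis bit_fps_two mult_2 mult_zero_left)

lemma bit_fps_diff [simp]: "(f :: bit fps) - g = f + g"
  by (simp add: diff_eq_eq add.assoc)

text \<open>In the convolution the terms \<open>i\<close> and \<open>n - i\<close> cancel in pairs,
  and the middle term is its own square root in the field with two elements. Squares thus live on
  even exponents, which is what the dissections use.\<close>

lemma bit_fps_square_nth:
  fixes f :: "bit fps"
  shows "(f\<^sup>2) $ n = (if even n then f $ (n div 2) else 0)"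
proof -
  define g where "g i = f $ i * f $ (n - i)" for i
  have self: "x + x = 0" for x :: bit by (cases x) auto
  have split: "{0..n} = {i\<in>{0..n}. 2 * i < n} \<union> {i\<in>{0..n}. 2 * i > n} \<union> {i\<in>{0..n}. 2 * i = n}"
    by auto
  have "(f\<^sup>2) $ n = sum g {0..n}"
    by (simp add: power2_eq_square fps_mult_nth g_def)
  also have "\<dots> = sum g {i\<in>{0..n}. 2 * i < n} + sum g {i\<in>{0..n}. 2 * i > n} + sum g {i\<in>{0..n}. 2 * i = n}"
    by (subst split, subst sum.union_disjoint, simp_all del: add_bit_eq_xor, blast,
        subst sum.union_disjoint, auto simp del: add_bit_eq_xor)
  also have "sum g {i\<in>{0..n}. 2 * i > n} = sum g {i\<in>{0..n}. 2 * i < n}"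
    by (rule sum.reindex_bij_witness[of _ "\<lambda>i. n - i" "\<lambda>i. n - i"])
       (auto simp: g_def mult.commute simp del: mult_bit_eq_and)
  also have "sum g {i\<in>{0..n}. 2 * i < n} + sum g {i\<in>{0..n}. 2 * i < n} = 0" by (rule self)
  also have "{i\<in>{0..n}. 2 * i = n} = (if even n then {n div 2} else {})" by auto
  also have "0 + sum g \<dots> = (if even n then f $ (n div 2) else 0)"
    by (cases "f $ (n div 2)") (auto simp: g_def elim!: evenE)
  finally show ?thesis .
qed

section \<open>Euler products and theta series modulo 2\<close>

lemma euler_fps_double:
  assumes "m > 0"
  shows "euler_fps (2 * m) = (euler_fps m :: bit fps)\<^sup>2"
proof (rule fps_eqI_upto)
  fix n
  have sq: "1 - fps_X ^ (2 * m * j) = (1 - fps_X ^ (m * j) :: bit fps)\<^sup>2" for j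
    by (simp add: power2_sum mult_ac flip: power_mult)
  have "fps_eq_upto n (euler_fps (2 * m) :: bit fps) (euler_prod (2 * m) n)"
    using assms by (intro euler_fps_eq_upto) auto
  also have "euler_prod (2 * m) n = (euler_prod m n :: bit fps)\<^sup>2"
    unfolding euler_prod_def sq by (simp only: prod_power_distrib)
  also have "fps_eq_upto n \<dots> ((euler_fps m)\<^sup>2)"
    using assms by (intro fps_eq_upto_power fps_eq_upto_sym[OF euler_fps_eq_upto]) auto
  finally show "fps_eq_upto n (euler_fps (2 * m) :: bit fps) ((euler_fps m)\<^sup>2)" .
qed

lemma euler_fps_nonzero: "m > 0 \<Longrightarrow> euler_fps m \<noteq> (0 :: 'a :: comm_ring_1 fps)"
  using euler_fps_nth_0[of m, where 'a='a] by auto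

text \<open>Only the residue class of \<open>2 c\<close> modulo \<open>4 c\<close> is missing from the triple product for
  \<open>f(q^c, q^(3 c))\<close>, so it times \<open>(q^(2 c); q^(2 c))\<close> is
  \<open>(q^c; q^c) (q^(4 c); q^(4 c))\<close> in characteristic 2.\<close>
lemma theta_fps_cube:
  assumes "c > 0"
  shows "theta_fps c (3 * c) = (euler_fps c :: bit fps) ^ 3"
proof -
  let ?E = "\<lambda>m n. euler_prod m n :: bit fps"
  let ?e = "\<lambda>m. euler_fps m :: bit fps"
  define H :: "nat \<Rightarrow> bit fps" where "H n = (\<Prod>j\<in>{1..n}. 1 + fps_X ^ (4 * c * j - 2 * c))" for n
  have H_Suc: "H (Suc n) = H n * (1 + fps_X ^ (c * (4 * n + 2)))" for n
  proof -
    have "4 * c * Suc n - 2 * c = c * (4 * n + 2)" by (simp add: algebra_simps)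
    thus ?thesis by (simp add: H_def mult.commute)
  qed
  have c4: "c + 3 * c = 4 * c" by simp
  have ex: "4 * c * Suc n - c = c * (4 * n + 3)" "4 * c * Suc n - 3 * c = c * (4 * n + 1)" for n
    by (simp_all add: algebra_simps)
  have ex': "4 * c * Suc n = c * (4 * n + 4)" "2 * c * (2 * n + 1) = c * (4 * n + 2)"
    "2 * c * (2 * n + 2) = c * (4 * n + 4)" for n
    by (simp_all add: algebra_simps)
  have nx: "Suc (4 * n) = 4 * n + 1" "Suc (4 * n + 1) = 4 * n + 2" "Suc (4 * n + 2) = 4 * n + 3"
    "Suc (4 * n + 3) = 4 * n + 4" "Suc (2 * n) = 2 * n + 1" "Suc (2 * n + 1) = 2 * n + 2" for n
    by simp_all
  have 1: "theta_prod c (3 * c) n * H n * ?E (4 * c) n = ?E c (4 * n)" for n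
  proof (induction n)
    case (Suc n)
    have "theta_prod c (3 * c) (Suc n) * H (Suc n) * ?E (4 * c) (Suc n) =
       (theta_prod c (3 * c) n * H n * ?E (4 * c) n) *
       ((1 + fps_X ^ (c * (4 * n + 3))) * (1 + fps_X ^ (c * (4 * n + 1))) *
       (1 + fps_X ^ (c * (4 * n + 2))) * (1 + fps_X ^ (c * (4 * n + 4))))"
      unfolding theta_prod_Suc H_Suc euler_prod_Suc bit_fps_diff c4 ex unfolding ex'
      by (simp only: mult_ac)
    also have "\<dots> = ?E c (Suc (Suc (Suc (Suc (4 * n)))))"
      unfolding Suc.IH euler_prod_Suc bit_fps_diff unfolding nx by (simp only: mult_ac)
    also have "Suc (Suc (Suc (Suc (4 * n)))) = 4 * Suc n" by simp
    finally show ?case .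
  qed (simp add: theta_prod_def H_def euler_prod_def)
  have 2: "H n * ?E (4 * c) n = ?E (2 * c) (2 * n)" for n
  proof (induction n)
    case (Suc n)
    have "H (Suc n) * ?E (4 * c) (Suc n) =
       (H n * ?E (4 * c) n) * ((1 + fps_X ^ (c * (4 * n + 2))) * (1 + fps_X ^ (c * (4 * n + 4))))"
      unfolding H_Suc euler_prod_Suc bit_fps_diff ex' by (simp only: mult_ac)
    also have "\<dots> = ?E (2 * c) (Suc (Suc (2 * n)))"
      unfolding Suc.IH euler_prod_Suc bit_fps_diff unfolding nx ex' by (simp only: mult_ac)
    also have "Suc (Suc (2 * n)) = 2 * Suc n" by simp
    finally show ?case .
  qed (simp add: H_def euler_prod_def)
  have "theta_fps c (3 * c) * ?e (2 * c) = ?e c * ?e (4 * c)"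
  proof (rule fps_eqI_upto)
    fix n
    have "fps_eq_upto n (theta_fps c (3 * c) * ?e (2 * c))
       (theta_prod c (3 * c) n * ?E (4 * c) n * ?E (2 * c) (2 * n))"
      using assms jacobi_triple_product_eq_upto[of c "3 * c" n, where 'a = bit]
      by (intro fps_eq_upto_mult euler_fps_eq_upto) (auto intro: fps_eq_upto_sym)
    also have "theta_prod c (3 * c) n * ?E (4 * c) n * ?E (2 * c) (2 * n) = ?E c (4 * n) * ?E (4 * c) n"
      unfolding 1[symmetric] 2[symmetric] by (simp only: mult_ac)
    also have "fps_eq_upto n \<dots> (?e c * ?e (4 * c))"
      using assms by (intro fps_eq_upto_mult fps_eq_upto_sym[OF euler_fps_eq_upto]) auto
    finally show "fps_eq_upto n (theta_fps c (3 * c) * ?e (2 * c)) (?e c * ?e (4 * c))" .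
  qed
  moreover have "?e (4 * c) = ?e c ^ 4"
    using euler_fps_double[of "2 * c"] euler_fps_double[of c] assms by (simp flip: power_mult)
  \<comment> \<open>Since \<open>?e (2 * c)\<close> is the square and \<open>?e (4 * c)\<close> the
    fourth power of \<open>?e c\<close>, the right side is the fifth power.\<close>
  ultimately have "theta_fps c (3 * c) * (?e c)\<^sup>2 = ?e c ^ 3 * (?e c)\<^sup>2"
    using euler_fps_double[of c] assms by (simp add: eval_nat_numeral mult_ac)
  thus ?thesis using euler_fps_nonzero[OF assms, where 'a = bit] by (metis mult_right_cancel power_not_zero)
qed

text \<open>The two theta products supply the residues 1, 4 and 2, 3 modulo 5. Each triple product
  brings one Euler product in \<open>q^5\<close>: one copy fills in residue 0, the other
  remains.\<close>

lemma theta_fps_quintic: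
  "theta_fps 1 4 * theta_fps 2 3 = (euler_fps 1 * euler_fps 5 :: bit fps)"
proof (rule fps_eqI_upto)
  fix n
  let ?E = "\<lambda>m n. euler_prod m n :: bit fps"
  have ex: "(1 + 4) * Suc n - 1 = 5 * n + 4" "(1 + 4) * Suc n - 4 = 5 * n + 1"
    "(2 + 3) * Suc n - 2 = 5 * n + 3" "(2 + 3) * Suc n - 3 = 5 * n + 2" for n by simp_all
  have ex': "5 * Suc n = 5 * n + 5" for n by simp
  have nx: "Suc (5 * n) = 5 * n + 1" "Suc (5 * n + 1) = 5 * n + 2" "Suc (5 * n + 2) = 5 * n + 3"
    "Suc (5 * n + 3) = 5 * n + 4" "Suc (5 * n + 4) = 5 * n + 5" for n by simp_all
  have 1: "theta_prod 1 4 n * theta_prod 2 3 n * ?E 5 n = ?E 1 (5 * n)" for n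
  proof (induction n)
    case (Suc n)
    have "theta_prod 1 4 (Suc n) * theta_prod 2 3 (Suc n) * ?E 5 (Suc n) =
       (theta_prod 1 4 n * theta_prod 2 3 n * ?E 5 n) *
       ((1 + fps_X ^ (5 * n + 4)) * (1 + fps_X ^ (5 * n + 1)) *
       (1 + fps_X ^ (5 * n + 3)) * (1 + fps_X ^ (5 * n + 2)) * (1 + fps_X ^ (5 * n + 5)))"
      unfolding theta_prod_Suc euler_prod_Suc bit_fps_diff ex unfolding ex'
      by (simp only: mult_ac)
    also have "\<dots> = ?E 1 (Suc (Suc (Suc (Suc (Suc (5 * n))))))"
      unfolding Suc.IH euler_prod_Suc bit_fps_diff unfolding nx mult_1 by (simp only: mult_ac)
    also have "Suc (Suc (Suc (Suc (Suc (5 * n))))) = 5 * Suc n" by simp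
    finally show ?case .
  qed (simp add: theta_prod_def euler_prod_def)
  have "fps_eq_upto n (theta_fps 1 4 * theta_fps 2 3)
     ((theta_prod 1 4 n * ?E 5 n) * (theta_prod 2 3 n * ?E 5 n))"
    using jacobi_triple_product_eq_upto[of 1 4 n, where 'a = bit]
      jacobi_triple_product_eq_upto[of 2 3 n, where 'a = bit]
    by (intro fps_eq_upto_mult) (auto intro: fps_eq_upto_sym)
  also have "(theta_prod 1 4 n * ?E 5 n) * (theta_prod 2 3 n * ?E 5 n) = ?E 1 (5 * n) * ?E 5 n"
    unfolding 1[symmetric] by (simp only: mult_ac)
  also have "fps_eq_upto n \<dots> (euler_fps 1 * euler_fps 5)"
    by (intro fps_eq_upto_mult fps_eq_upto_sym[OF euler_fps_eq_upto]) auto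
  finally show "fps_eq_upto n (theta_fps 1 4 * theta_fps 2 3) (euler_fps 1 * euler_fps 5 :: bit fps)" .
qed

section \<open>Counting Gaussian integers\<close>

lemma theta_fps_mult_nth:
  assumes "a > 0" "b > 0" "c > 0" "d > 0"
  shows "(theta_fps a b * theta_fps c d) $ r =
    (of_nat (card {(k, l). theta_exp a b k + theta_exp c d l = r}) :: 'a :: comm_ring_1)"
proof -
  let ?A = "\<lambda>i. {k. theta_exp a b k = i}" and ?B = "\<lambda>i. {k. theta_exp c d k = i}"
  have fin: "finite (?A i)" "finite (?B i)" for i
    using assms by (simp_all add: finite_theta_set)
  have "{(k, l). theta_exp a b k + theta_exp c d l = r} = (\<Union>i\<in>{0..r}. ?A i \<times> ?B (r - i))"
    by auto
  also have "card \<dots> = (\<Sum>i=0..r. card (?A i \<times> ?B (r - i)))"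
    using fin by (intro card_UN_disjoint) auto
  finally have "card {(k, l). theta_exp a b k + theta_exp c d l = r} = (\<Sum>i=0..r. card (?A i) * card (?B (r - i)))"
    by (simp add: card_cartesian_product)
  thus ?thesis by (simp add: fps_mult_nth theta_fps_def theta_set_eq)
qed

text \<open>For odd \<open>N\<close>, one element from each class of associates of Gaussian integers of norm \<open>N\<close>.\<close>
definition gauss_reps :: "nat \<Rightarrow> (int \<times> int) set" where
  "gauss_reps N = {(u, v). u\<^sup>2 + v\<^sup>2 = int N \<and> odd u \<and> u > 0}"

lemma finite_two_squares: "finite {(u, v). u\<^sup>2 + v\<^sup>2 = int N}"
proof (rule finite_subset)
  have sq: "\<bar>x\<bar> \<le> x\<^sup>2" for x :: int
    using theta_exp_ge[of 1 1 x] double_theta_exp[of 1 1 x] by (simp add: power2_eq_square algebra_simps)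
  show "{(u, v). u\<^sup>2 + v\<^sup>2 = int N} \<subseteq> {- int N..int N} \<times> {- int N..int N}"
  proof safe
    fix u v :: int assume "u\<^sup>2 + v\<^sup>2 = int N"
    moreover have "u\<^sup>2 \<ge> 0" "v\<^sup>2 \<ge> 0" by simp_all
    ultimately show "u \<in> {- int N..int N}" "v \<in> {- int N..int N}"
      using sq[of u] sq[of v] by auto
  qed
qed simp

lemma finite_gauss_reps: "finite (gauss_reps N)"
  by (rule finite_subset[OF _ finite_two_squares[of N]]) (auto simp: gauss_reps_def)

text \<open>Complex conjugation pairs off the elements with nonzero imaginary part.\<close>
lemma odd_card_gauss_reps:
  assumes "odd N"
  shows "odd (card (gauss_reps N)) \<longleftrightarrow> (\<exists>s. N = s\<^sup>2)"
proof -
  let ?P = "{(u, v) \<in> gauss_reps N. v > 0}" and ?M = "{(u, v) \<in> gauss_reps N. v < 0}"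
  let ?Z = "{(u, v) \<in> gauss_reps N. v = 0}"
  have fin: "finite ?P" "finite ?M" "finite ?Z"
    by (rule finite_subset[OF _ finite_gauss_reps[of N]]; auto)+
  have "gauss_reps N = ?P \<union> ?M \<union> ?Z" by auto
  hence "card (gauss_reps N) = card (?P \<union> ?M \<union> ?Z)" by (rule arg_cong)
  also have "\<dots> = card ?P + card ?M + card ?Z"
    using fin by (subst card_Un_disjoint; (auto; fail | subst card_Un_disjoint; auto)?)
  also have "card ?M = card ?P"
    by (rule bij_betw_same_card[of "\<lambda>(u, v). (u, - v)"],
        rule bij_betw_byWitness[of _ "\<lambda>(u, v). (u, - v)"]) (auto simp: gauss_reps_def)
  finally have "odd (card (gauss_reps N)) \<longleftrightarrow> odd (card ?Z)" by simp
  also have "card ?Z = (if \<exists>s. N = s\<^sup>2 then 1 else 0)"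
  proof (cases "\<exists>s. N = s\<^sup>2")
    case True
    then obtain s where s: "N = s\<^sup>2" by blast
    have "odd s" using assms s by simp
    hence "?Z = {(int s, 0)}"
      using s by (auto simp: gauss_reps_def power2_eq_iff odd_pos)
    thus ?thesis using True by simp
  next
    case False
    have "(u, 0) \<notin> gauss_reps N" for u
    proof
      assume "(u, 0) \<in> gauss_reps N"
      hence "int ((nat u)\<^sup>2) = int N" by (simp add: gauss_reps_def)
      thus False using False by (metis of_nat_eq_iff)
    qed
    hence Z: "?Z = {}" by auto
    show ?thesis unfolding Z using False by simp
  qed
  finally show ?thesis by auto
qed

text \<open>The condition says that \<open>u + v i\<close> is divisible by \<open>1 - 2 i\<close>; the bijection is multiplication
  by \<open>1 - 2 i\<close>, up to sign.\<close>
lemma card_gauss_reps_div_5: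
  "card {(u, v) \<in> gauss_reps (5 * M). 5 dvd u + 3 * v} = card (gauss_reps M)"
proof -
  define f :: "int \<times> int \<Rightarrow> int \<times> int" where
    "f = (\<lambda>(u, v). (sgn (u + 2 * v) * (u + 2 * v), sgn (u + 2 * v) * (v - 2 * u)))"
  \<comment> \<open>Division by \<open>1 - 2 i\<close>, i.e. multiplication by
    \<open>(1 + 2 i) / 5\<close>. The sign makes the real part positive. The divisibility condition
    says \<open>u = 2 v\<close> modulo 5, which makes both quotients exact.\<close>
  define g :: "int \<times> int \<Rightarrow> int \<times> int" where
    "g = (\<lambda>(u, v). (sgn (u - 2 * v) * ((u - 2 * v) div 5), sgn (u - 2 * v) * ((2 * u + v) div 5)))"
  have "bij_betw f (gauss_reps M) {(u, v) \<in> gauss_reps (5 * M). 5 dvd u + 3 * v}"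
  proof (rule bij_betw_byWitness[of _ g]; safe)
    fix u v assume uv: "(u, v) \<in> gauss_reps M"
    hence "odd (u + 2 * v)" by (simp add: gauss_reps_def)
    hence nz: "u + 2 * v \<noteq> 0" by (metis even_zero)
    have u: "u > 0" using uv by (simp add: gauss_reps_def)
    show "g (f (u, v)) = (u, v)"
      using nz u by (cases "u + 2 * v > 0") (auto simp: f_def g_def sgn_if)
  next
    fix u v assume uv: "(u, v) \<in> gauss_reps (5 * M)" "5 dvd u + 3 * v"
    hence u: "u > 0" by (simp add: gauss_reps_def)
    from uv(2) obtain w where w: "u = 5 * w - 3 * v" by (auto elim!: dvdE simp: algebra_simps)
    have "odd (u - 2 * v)" using uv by (simp add: gauss_reps_def)
    hence nz: "u - 2 * v \<noteq> 0" by (metis even_zero)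
    have d: "(u - 2 * v) div 5 = w - v" "(2 * u + v) div 5 = 2 * w - v" unfolding w by simp_all
    show "f (g (u, v)) = (u, v)"
      unfolding f_def g_def using nz u w d by (auto simp: sgn_if)
  next
    fix u v a b assume uv: "(u, v) \<in> gauss_reps M" and ab: "(a, b) = f (u, v)"
    hence "odd (u + 2 * v)" by (simp add: gauss_reps_def)
    hence nz: "u + 2 * v \<noteq> 0" by (metis even_zero)
    have "(u + 2 * v)\<^sup>2 + (v - 2 * u)\<^sup>2 = 5 * (u\<^sup>2 + v\<^sup>2)"
      by (simp add: power2_eq_square algebra_simps)
    moreover have "a\<^sup>2 = (u + 2 * v)\<^sup>2" "b\<^sup>2 = (v - 2 * u)\<^sup>2"
    proof -
      define \<sigma> where "\<sigma> = sgn (u + 2 * v)"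
      have "\<sigma>\<^sup>2 = 1" using nz by (simp add: \<sigma>_def sgn_if)
      moreover have "a = \<sigma> * (u + 2 * v)" "b = \<sigma> * (v - 2 * u)"
        using ab by (simp_all add: f_def \<sigma>_def)
      ultimately show "a\<^sup>2 = (u + 2 * v)\<^sup>2" "b\<^sup>2 = (v - 2 * u)\<^sup>2"
        by (simp_all only: power_mult_distrib mult_1)
    qed
    moreover have "a > 0" "odd a"
      using uv nz ab by (auto simp: gauss_reps_def f_def sgn_if split: if_splits)
    ultimately have "a\<^sup>2 + b\<^sup>2 = int (5 * M)" "a > 0" "odd a"
      using uv by (simp_all add: gauss_reps_def)
    thus "(a, b) \<in> gauss_reps (5 * M)" by (simp add: gauss_reps_def)
    have "5 dvd (u + 2 * v) + 3 * (v - 2 * u)" by presburger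
    hence "5 dvd s * (u + 2 * v) + 3 * (s * (v - 2 * u))" for s
      using dvd_mult[of 5 "(u + 2 * v) + 3 * (v - 2 * u)" s] by (simp add: algebra_simps)
    thus "5 dvd a + 3 * b" using ab by (simp add: f_def)
  next
    fix u v a b assume uv: "(u, v) \<in> gauss_reps (5 * M)" "5 dvd u + 3 * v" and ab: "(a, b) = g (u, v)"
    from uv(2) obtain w where w: "u = 5 * w - 3 * v" by (auto elim!: dvdE simp: algebra_simps)
    have u: "odd u" "u\<^sup>2 + v\<^sup>2 = 5 * int M" using uv by (simp_all add: gauss_reps_def)
    have d: "(u - 2 * v) div 5 = w - v" "(2 * u + v) div 5 = 2 * w - v" unfolding w by simp_all
    have o: "odd (w - v)" using u(1) unfolding w by simp
    have "5 * ((w - v)\<^sup>2 + (2 * w - v)\<^sup>2) = u\<^sup>2 + v\<^sup>2"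
      unfolding w by (simp add: power2_eq_square algebra_simps)
    hence e: "(w - v)\<^sup>2 + (2 * w - v)\<^sup>2 = int M" using u by simp
    have "u - 2 * v = 5 * (w - v)" using w by simp
    hence sg: "sgn (u - 2 * v) = sgn (w - v)" by (simp only: sgn_mult) simp
    have "w - v \<noteq> 0" using o by auto
    thus "(a, b) \<in> gauss_reps M"
      using ab d e o sg by (auto simp: gauss_reps_def g_def sgn_if power2_commute)
  qed
  thus ?thesis by (rule bij_betw_same_card[symmetric])
qed

text \<open>Multiplication by \<open>i\<close> multiplies \<open>s + 3 t\<close> by 3, a primitive root modulo 5, so every class of
  associates not divisible by \<open>1 - 2 i\<close> has exactly one member with residue 4.\<close>
lemma card_residue_class_eq:
  assumes "odd N"
  shows "card {(s, t). s\<^sup>2 + t\<^sup>2 = int N \<and> (s + 3 * t) mod 5 = 4} =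
         card {(u, v) \<in> gauss_reps N. \<not> 5 dvd u + 3 * v}"
proof -
  \<comment> \<open>The units 1, -1, -i, i take the residues 4, 1, 2, 3 to 4. The inverse
    \<open>g\<close> picks the unit that makes the real part odd and positive.\<close>
  define f :: "int \<times> int \<Rightarrow> int \<times> int" where
    "f = (\<lambda>(u, v). let c = (u + 3 * v) mod 5 in
       if c = 4 then (u, v) else if c = 1 then (-u, -v) else if c = 2 then (v, -u) else (-v, u))"
  define g :: "int \<times> int \<Rightarrow> int \<times> int" where
    "g = (\<lambda>(s, t). if odd s then if s > 0 then (s, t) else (-s, -t)
                   else if t > 0 then (t, -s) else (-t, s))"
  have par: "odd u \<longleftrightarrow> even v" if "u\<^sup>2 + v\<^sup>2 = int N" for u v
  proof -
    have "odd (u\<^sup>2 + v\<^sup>2)" using that assms by simp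
    thus ?thesis by simp
  qed
  have "bij_betw g {(s, t). s\<^sup>2 + t\<^sup>2 = int N \<and> (s + 3 * t) mod 5 = 4}
          {(u, v) \<in> gauss_reps N. \<not> 5 dvd u + 3 * v}"
  proof (rule bij_betw_byWitness[of _ f]; safe)
    fix s t assume st: "s\<^sup>2 + t\<^sup>2 = int N" "(s + 3 * t) mod 5 = 4"
    have "(- s + 3 * (- t)) mod 5 = 1" "(t + 3 * (- s)) mod 5 = 3" "(- t + 3 * s) mod 5 = 2"
      "(- (3 * t) - s) mod 5 = 1"
      using st(2) by presburger+
    thus "f (g (s, t)) = (s, t)"
      using st(2) by (auto simp: f_def g_def Let_def)
  next
    fix u v assume uv: "(u, v) \<in> gauss_reps N" "\<not> 5 dvd u + 3 * v"
    thus "g (f (u, v)) = (u, v)"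
      using par[of u v] by (auto simp: f_def g_def Let_def gauss_reps_def)
  next
    fix s t u v assume st: "s\<^sup>2 + t\<^sup>2 = int N" "(s + 3 * t) mod 5 = 4" and uv: "(u, v) = g (s, t)"
    show "(u, v) \<in> gauss_reps N"
      using uv st(1) par[OF st(1)] 
      by (cases "s = 0"; cases "t = 0") (auto simp: g_def gauss_reps_def add.commute split: if_splits)
    assume "5 dvd u + 3 * v"
    hence "5 dvd s + 3 * t \<or> 5 dvd - s + 3 * - t \<or> 5 dvd t + 3 * - s \<or> 5 dvd - t + 3 * s"
      using uv by (auto simp: g_def split: if_splits)
    thus False
    proof (elim disjE)
      assume "5 dvd s + 3 * t" thus False using st(2) by presburger
    next
      assume "5 dvd - s + 3 * - t" thus False using st(2) by presburger
    next
      assume "5 dvd t + 3 * - s" thus False using st(2) by presburger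
    next
      assume "5 dvd - t + 3 * s" thus False using st(2) by presburger
    qed
  next
    fix s t u v assume uv: "(u, v) \<in> gauss_reps N" "\<not> 5 dvd u + 3 * v" and st: "(s, t) = f (u, v)"
    show "s\<^sup>2 + t\<^sup>2 = int N"
      using uv st by (auto simp: f_def Let_def gauss_reps_def add.commute split: if_splits)
    have "(u + 3 * v) mod 5 = 4 \<or> (u + 3 * v) mod 5 = 1 \<or> (u + 3 * v) mod 5 = 2 \<or> (u + 3 * v) mod 5 = 3"
      using uv(2) by presburger
    then consider "(u + 3 * v) mod 5 = 4" | "(u + 3 * v) mod 5 = 1" | "(u + 3 * v) mod 5 = 2" | "(u + 3 * v) mod 5 = 3"
      by blast
    thus "(s + 3 * t) mod 5 = 4"
      by cases (use st in \<open>simp_all add: f_def Let_def\<close>; presburger)+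
  qed
  thus ?thesis by (rule bij_betw_same_card)
qed

text \<open>Completing squares turns the equation into \<open>x^2 + y^2 = 10 (4 r + 1)\<close> with
  \<open>x = 10 k - 3\<close> and \<open>y = 10 l - 1\<close>; the bijection divides \<open>x + y i\<close> by \<open>3 + i\<close>.\<close>
lemma card_quintic_theta:
  "card {(k, l). theta_exp 1 4 k + theta_exp 2 3 l = r} =
   card {(s, t). s\<^sup>2 + t\<^sup>2 = int (4 * r + 1) \<and> (s + 3 * t) mod 5 = 4}"
proof -
  define f :: "int \<times> int \<Rightarrow> int \<times> int" where "f = (\<lambda>(k, l). (3 * k + l - 1, 3 * l - k))"
  \<comment> \<open>If \<open>(s, t) = f (k, l)\<close>, then \<open>s + 3 * t = 10 * l - 1\<close>
    and \<open>k = 3 * l - t\<close>.\<close>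
  define g :: "int \<times> int \<Rightarrow> int \<times> int" where
    "g = (\<lambda>(s, t). (3 * ((s + 3 * t + 1) div 10) - t, (s + 3 * t + 1) div 10))"
  have key: "theta_exp 1 4 k + theta_exp 2 3 l = r \<longleftrightarrow>
     (3 * k + l - 1)\<^sup>2 + (3 * l - k)\<^sup>2 = int (4 * r + 1)" for k l
  proof -
    have key0: "(3 * k + l - 1)\<^sup>2 + (3 * l - k)\<^sup>2 = 2 * (2 * int (theta_exp 1 4 k) + 2 * int (theta_exp 2 3 l)) + 1"
      unfolding double_theta_exp by (simp add: power2_eq_square algebra_simps)
    show ?thesis unfolding key0 by arith
  qed
  have "bij_betw f {(k, l). theta_exp 1 4 k + theta_exp 2 3 l = r}
    {(s, t). s\<^sup>2 + t\<^sup>2 = int (4 * r + 1) \<and> (s + 3 * t) mod 5 = 4}"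
  proof (rule bij_betw_byWitness[of _ g]; safe)
    fix k l show "g (f (k, l)) = (k, l)" by (simp add: f_def g_def)
  next
    fix k l s t assume kl: "r = theta_exp 1 4 k + theta_exp 2 3 l" and st: "(s, t) = f (k, l)"
    show "s\<^sup>2 + t\<^sup>2 = int (4 * (theta_exp 1 4 k + theta_exp 2 3 l) + 1)"
      using key[of k l] st unfolding kl f_def by simp
    show "(s + 3 * t) mod 5 = 4" using st unfolding f_def by simp presburger
  next
    fix s t :: int assume st: "s\<^sup>2 + t\<^sup>2 = int (4 * r + 1)" "(s + 3 * t) mod 5 = 4"
    \<comment> \<open>Oddness of the norm sharpens residue 4 modulo 5 to residue 9 modulo 10, so
      that \<open>l\<close> is an integer.\<close>
    have "odd (s\<^sup>2 + t\<^sup>2)" unfolding st by simp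
    hence "odd (s + 3 * t)" by simp
    moreover have "\<exists>l. x = 10 * l - 1" if "odd x" "x mod 5 = 4" for x :: int
      using that by presburger
    ultimately obtain l where l: "s + 3 * t = 10 * l - 1" using st(2) by blast
    hence s: "s = 10 * l - 1 - 3 * t" by simp
    have g: "g (s, t) = (3 * l - t, l)" unfolding g_def s by simp
    show fg: "f (g (s, t)) = (s, t)" unfolding g by (simp add: f_def s)
    fix k' l' assume "(k', l') = g (s, t)"
    hence kl: "k' = 3 * l - t" "l' = l" unfolding g by simp_all
    have "3 * k' + l' - 1 = s" "3 * l' - k' = t" unfolding kl s by simp_all
    thus "theta_exp 1 4 k' + theta_exp 2 3 l' = r"
      using st(1) unfolding key by simp
  qed
  thus ?thesis by (rule bij_betw_same_card)
qed

section \<open>Parity of the theta coefficients\<close>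

lemma bit_of_nat: "(of_nat n :: bit) = of_bool (odd n)"
  by (induction n) auto

text \<open>Conjugation swaps \<open>1 - 2 i\<close> and \<open>1 + 2 i\<close>, so it does not act
  on the elements prime to \<open>1 - 2 i\<close>. They are counted as all elements of norm
  \<open>N\<close> minus the multiples of \<open>1 - 2 i\<close>, which correspond to norm
  \<open>N / 5\<close>. Conjugation acts on both of these sets of representatives, and the
  difference of counts becomes an exclusive or.\<close>

lemma quintic_theta_nth:
  "(theta_fps 1 4 * theta_fps 2 3 :: bit fps) $ r =
     of_bool ((\<exists>s. 4 * r + 1 = s\<^sup>2) \<noteq> (\<exists>s. 4 * r + 1 = 5 * s\<^sup>2))"
proof -
  define N where "N = 4 * r + 1"
  have oddN: "odd N" by (simp add: N_def)
  let ?V = "gauss_reps N"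
  let ?A = "{(u, v) \<in> ?V. 5 dvd u + 3 * v}" and ?B = "{(u, v) \<in> ?V. \<not> 5 dvd u + 3 * v}"
  have fin: "finite ?A" "finite ?B"
    by (rule finite_subset[OF _ finite_gauss_reps[of N]]; auto)+
  have "?V = ?A \<union> ?B" by auto
  hence "card ?V = card (?A \<union> ?B)" by (rule arg_cong)
  also have "\<dots> = card ?A + card ?B" using fin by (intro card_Un_disjoint) auto
  finally have "odd (card ?B) \<longleftrightarrow> odd (card ?V) \<noteq> odd (card ?A)" by auto
  moreover have "odd (card ?A) \<longleftrightarrow> (\<exists>s. N = 5 * s\<^sup>2)"
  proof (cases "5 dvd N")
    case True
    then obtain M where M: "N = 5 * M" by blast
    hence "odd M" using oddN by simp
    from odd_card_gauss_reps[OF this] show ?thesis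
      unfolding M card_gauss_reps_div_5 by simp
  next
    case False
    have "\<not> 5 dvd u + 3 * v" if "(u, v) \<in> ?V" for u v
    proof
      assume "5 dvd u + 3 * v"
      with that have uv: "(u, v) \<in> ?V" "5 dvd u + 3 * v"
 by auto
      from uv(2) obtain w where w: "u = 5 * w - 3 * v" by (auto elim!: dvdE simp: algebra_simps)
      have "int N = u\<^sup>2 + v\<^sup>2" using uv by (simp add: gauss_reps_def)
      also have "\<dots> = 5 * (5 * w\<^sup>2 - 6 * w * v + 2 * v\<^sup>2)"
        unfolding w by (simp add: power2_eq_square algebra_simps)
      finally have "int 5 dvd int N" by simp
      hence "5 dvd N" by (simp only: of_nat_dvd_iff)
      thus False using False by simp
    qed
    hence A: "?A = {}" by blast
    show ?thesis unfolding A using False by auto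
  qed
  ultimately have "odd (card ?B) \<longleftrightarrow> (\<exists>s. N = s\<^sup>2) \<noteq> (\<exists>s. N = 5 * s\<^sup>2)"
    using odd_card_gauss_reps[OF oddN] by simp
  hence "odd (card {(k, l). theta_exp 1 4 k + theta_exp 2 3 l = r}) \<longleftrightarrow> (\<exists>s. N = s\<^sup>2) \<noteq> (\<exists>s. N = 5 * s\<^sup>2)"
    unfolding card_quintic_theta N_def[symmetric] card_residue_class_eq[OF oddN] .
  thus ?thesis by (simp add: theta_fps_mult_nth bit_of_nat N_def)
qed

text \<open>Completing the square gives \<open>8 * i + c = c * (4 * k - 1)^2\<close>. For odd
  \<open>s\<close> exactly one of \<open>s\<close> and \<open>-s\<close> has the form
  \<open>4 * k - 1\<close>, so there is at most one \<open>k\<close>.\<close>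

lemma cube_theta_nth:
  assumes "odd c"
  shows "(theta_fps c (3 * c) :: bit fps) $ i = of_bool (\<exists>s. 8 * i + c = c * s\<^sup>2)"
proof -
  have c: "c > 0" using assms by (rule odd_pos)
  define A where "A = {k. theta_exp c (3 * c) k = i}"
  have A: "k \<in> A \<longleftrightarrow> int c * (4 * k - 1)\<^sup>2 = int (8 * i + c)" for k
  proof -
    have "int c * (4 * k - 1)\<^sup>2 = 4 * (2 * int (theta_exp c (3 * c) k)) + int c"
      unfolding double_theta_exp by (simp add: power2_eq_square algebra_simps)
    thus ?thesis unfolding A_def by auto
  qed
  have "card A = of_bool (\<exists>s. 8 * i + c = c * s\<^sup>2)"
  proof (cases "\<exists>s. 8 * i + c = c * s\<^sup>2")
    case True
    then obtain s where s: "8 * i + c = c * s\<^sup>2" by blast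
    have "odd (8 * i + c)" using assms by simp
    hence "odd s" unfolding s by simp
    have "\<exists>k. 4 * k - 1 = z \<or> 4 * k - 1 = - z" if "odd z" for z :: int
      using that by presburger
    from this[of "int s"] \<open>odd s\<close> obtain k0 where k0: "4 * k0 - 1 = int s \<or> 4 * k0 - 1 = - int s"
      by auto
    have "A = {k0}"
    proof -
      have "k \<in> A \<longleftrightarrow> (4 * k - 1)\<^sup>2 = (int s)\<^sup>2" for k
        unfolding A s using c by simp
      hence "k \<in> A \<longleftrightarrow> 4 * k - 1 = int s \<or> 4 * k - 1 = - int s" for k
        by (simp add: power2_eq_iff)
      moreover have "k = k0" if "4 * k - 1 = int s \<or> 4 * k - 1 = - int s" for k
        using that k0 by presburger
      ultimately show ?thesis using k0 by blast
    qed
    thus ?thesis using True by simp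
  next
    case False
    have "A = {}"
    proof (rule ccontr)
      assume "A \<noteq> {}"
      then obtain k where "int c * (4 * k - 1)\<^sup>2 = int (8 * i + c)" using A by blast
      hence "int (c * (nat \<bar>4 * k - 1\<bar>)\<^sup>2) = int (8 * i + c)" by simp
      thus False using False by (metis of_nat_eq_iff)
    qed
    thus ?thesis using False by simp
  qed
  thus ?thesis
    unfolding theta_fps_def theta_set_eq fps_nth_Abs_fps A_def[symmetric] bit_of_nat by simp
qed

lemma square_mod_8: "(s::nat)\<^sup>2 mod 8 \<in> {0, 1, 4}"
proof -
  have "s\<^sup>2 mod 8 = (s mod 8)\<^sup>2 mod 8" by (simp add: power_mod)
  moreover have "s mod 8 \<in> {0,1,2,3,4,5,6,7}" using mod_less_divisor[of 8 s] by force
  ultimately show ?thesis by auto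
qed

text \<open>Odd squares are 1 modulo 8. So \<open>4 * r + 1\<close> can be a square only for even
  \<open>r\<close> and five times a square only for odd \<open>r\<close>. These two cases are the
  even part \<open>f_1^6\<close> and the odd part \<open>q f_5^6\<close>, both squares of cubes that
  are theta series.\<close>

lemma euler_fps_1_5:
  "(euler_fps 1 * euler_fps 5 :: bit fps) = euler_fps 1 ^ 6 + fps_X * euler_fps 5 ^ 6"
proof -
  have cube: "euler_fps 1 ^ 6 = (theta_fps 1 3 :: bit fps)\<^sup>2" "euler_fps 5 ^ 6 = (theta_fps 5 15 :: bit fps)\<^sup>2"
    using theta_fps_cube[of 1] theta_fps_cube[of 5] by (simp_all flip: power_mult)
  have not1: "8 * i + 5 \<noteq> s\<^sup>2" for i s :: nat
  proof
    assume "8 * i + 5 = s\<^sup>2"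
    hence "(8 * i + 5) mod 8 \<in> {0, 1, 4}" using square_mod_8[of s] by simp
    thus False by simp
  qed
  have not5: "8 * i + 1 \<noteq> 5 * s\<^sup>2" for i s :: nat
  proof
    assume "8 * i + 1 = 5 * s\<^sup>2"
    hence "(8 * i + 1) mod 8 = (5 * (s\<^sup>2 mod 8)) mod 8" by (simp only: mod_mult_right_eq)
    moreover have "(8 * i + 1) mod 8 = 1" by simp
    moreover have "(5 * x) mod 8 \<noteq> 1" if "x \<in> {0, 1, 4}" for x :: nat
      using that by auto
    ultimately show False using square_mod_8[of s] by metis
  qed
  show ?thesis
  proof (rule fps_ext)
    fix r
    show "(euler_fps 1 * euler_fps 5 :: bit fps) $ r = (euler_fps 1 ^ 6 + fps_X * euler_fps 5 ^ 6) $ r"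
    proof (cases "even r")
      case True
      then obtain i where i: "r = 2 * i" by blast
      have r: "4 * r + 1 = 8 * i + 1" by (simp add: i)
      have "(fps_X * (theta_fps 5 15)\<^sup>2 :: bit fps) $ r = 0"
        by (cases i) (simp_all add: i bit_fps_square_nth)
      moreover have "((theta_fps 1 3)\<^sup>2 :: bit fps) $ r = of_bool (\<exists>s. 8 * i + 1 = s\<^sup>2)"
        using cube_theta_nth[of 1 i] by (simp add: i bit_fps_square_nth)
      ultimately show ?thesis
        unfolding theta_fps_quintic[symmetric] quintic_theta_nth cube fps_add_nth r
        using not5[of i] by simp
    next
      case False
      then obtain i where i: "r = 2 * i + 1" by (elim oddE)
      have r: "4 * r + 1 = 8 * i + 5" by (simp add: i)
      have "(fps_X * (theta_fps 5 15)\<^sup>2 :: bit fps) $ r = of_bool (\<exists>s. 8 * i + 5 = 5 * s\<^sup>2)"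
        using cube_theta_nth[of 5 i] by (simp add: i bit_fps_square_nth)
      moreover have "((theta_fps 1 3)\<^sup>2 :: bit fps) $ r = 0"
        by (simp add: i bit_fps_square_nth)
      ultimately show ?thesis
        unfolding theta_fps_quintic[symmetric] quintic_theta_nth cube fps_add_nth r
        using not1[of i] by simp
    qed
  qed
qed

section \<open>The coefficients modulo 2\<close>

definition fps_mod_2 :: "int fps \<Rightarrow> bit fps" where
  "fps_mod_2 f = Abs_fps (\<lambda>n. of_int (f $ n))"

lemma fps_mod_2_nth [simp]: "fps_mod_2 f $ n = of_int (f $ n)"
  by (simp add: fps_mod_2_def)

lemma fps_mod_2_mult: "fps_mod_2 (f * g) = fps_mod_2 f * fps_mod_2 g"
  by (rule fps_ext) (simp only: fps_mod_2_nth fps_mult_nth of_int_sum of_int_mult)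

lemma fps_mod_2_1: "fps_mod_2 1 = 1"
  by (simp add: fps_eq_iff)

lemma fps_mod_2_power: "fps_mod_2 (f ^ n) = fps_mod_2 f ^ n"
  by (induction n) (simp_all add: fps_mod_2_mult fps_mod_2_1)

lemma fps_mod_2_prod: "fps_mod_2 (prod f A) = (\<Prod>x\<in>A. fps_mod_2 (f x))"
  by (induction A rule: infinite_finite_induct) (simp_all add: fps_mod_2_mult fps_mod_2_1)

lemma fps_mod_2_euler_prod: "fps_mod_2 (euler_prod m n) = euler_prod m n"
  unfolding euler_prod_def fps_mod_2_prod
  by (intro prod.cong refl) (auto simp: fps_eq_iff)

lemma fps_mod_2_qpoch_inf: "fps_mod_2 (qpoch_inf m) = euler_fps m"
proof (rule fps_ext)
  fix n
  have "fps_mod_2 (qpoch_inf m) $ n = fps_mod_2 (euler_prod m n) $ n"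
    by (simp add: qpoch_inf_def euler_prod_def)
  thus "fps_mod_2 (qpoch_inf m) $ n = euler_fps m $ n"
    by (simp only: fps_mod_2_euler_prod euler_fps_def fps_nth_Abs_fps)
qed

text \<open>Modulo 2, \<open>F f_1 f_10^5 = f_2 f_5^5\<close> becomes
  \<open>F f_1 f_5^10 = f_1^2 f_5^5\<close>, and \<open>f_1 f_5^5\<close> cancels.\<close>

lemma fps_mod_2_j10_F:
  "fps_mod_2 j10_F * euler_fps 5 ^ 5 = (euler_fps 1 :: bit fps)"
proof -
  let ?e = "\<lambda>m. euler_fps m :: bit fps"
  have q: "qpoch_inf m = euler_fps m" for m
    by (simp add: qpoch_inf_def euler_fps_def euler_prod_def)
  define D where "D = qpoch_inf 1 * qpoch_inf 10 ^ 5"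
  \<comment> \<open>The second argument of \<open>fps_right_inverse\<close> has to invert the
    constant term of \<open>D\<close>, which is 1.\<close>
  have "D $ 0 * 1 = 1" by (simp add: D_def q euler_fps_nth_0 fps_nth_power_0)
  hence "D * fps_right_inverse D 1 = 1" by (rule fps_right_inverse)
  moreover have "j10_F * D = qpoch_inf 2 * qpoch_inf 5 ^ 5 * (D * fps_right_inverse D 1)"
    unfolding j10_F_def D_def[symmetric] by (simp only: mult_ac)
  ultimately have "j10_F * D = qpoch_inf 2 * qpoch_inf 5 ^ 5" by simp
  from arg_cong[OF this, of fps_mod_2]
  have "fps_mod_2 j10_F * (?e 1 * ?e 10 ^ 5) = ?e 2 * ?e 5 ^ 5"
    by (simp add: D_def fps_mod_2_mult fps_mod_2_power fps_mod_2_qpoch_inf)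
  hence "(fps_mod_2 j10_F * ?e 5 ^ 5) * (?e 1 * ?e 5 ^ 5) = ?e 1 * (?e 1 * ?e 5 ^ 5)"
    using euler_fps_double[of 1] euler_fps_double[of 5]
    by (simp add: power2_eq_square power_mult_distrib mult_ac)
  thus ?thesis using euler_fps_nonzero[of 1, where 'a = bit] euler_fps_nonzero[of 5, where 'a = bit] by simp
qed

text \<open>\<open>F\<close> carries an extra factor \<open>q\<close>, so the index
  \<open>4 * r + 1\<close> of \<open>J10\<close> becomes \<open>4 * r + 2\<close>. It is halved to
  \<open>2 * r + 1\<close>, and the odd part is then halved to \<open>r\<close>.\<close>

lemma j10_F_nth_mod_2:
  "(of_int (j10_F $ (4 * r + 2)) :: bit) = (euler_fps 1 * euler_fps 5) $ r"
proof -
  define F where "F = fps_mod_2 j10_F"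
  define f :: "bit fps" where "f = euler_fps 1"
  define g :: "bit fps" where "g = euler_fps 5"
  define h where "h = inverse g"
  have gh: "g * h = 1"
    unfolding h_def g_def by (intro inverse_mult_eq_1') (simp add: euler_fps_nth_0)
  have Fg: "F * g ^ 5 = f" using fps_mod_2_j10_F by (simp add: F_def f_def g_def)
  have fg: "f * g = f ^ 6 + fps_X * g ^ 6" using euler_fps_1_5 by (simp add: f_def g_def)
  \<comment> \<open>Two successive 2-dissections: \<open>F = a^2 + X\<close>, and \<open>a\<close> is a square plus \<open>X (f g)^2\<close>.\<close>
  define a where "a = f ^ 3 * h ^ 3"
  have gh': "g ^ n * h ^ n = 1" for n by (simp add: gh flip: power_mult_distrib)
  have "F = F * (g ^ 6 * h ^ 6)" by (simp add: gh')
  also have "\<dots> = (F * g ^ 5) * g * h ^ 6" by (simp add: eval_nat_numeral mult_ac)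
  also have "\<dots> = (f ^ 6 + fps_X * g ^ 6) * h ^ 6" by (simp only: Fg fg)
  also have "\<dots> = f ^ 6 * h ^ 6 + fps_X * (g ^ 6 * h ^ 6)" by (simp only: algebra_simps)
  also have "\<dots> = a\<^sup>2 + fps_X" by (simp add: gh' a_def power_mult_distrib flip: power_mult)
  finally have F: "F = a\<^sup>2 + fps_X" .
  have "f\<^sup>2 * (f * g) * h ^ 4 = a * (g * h)"
    by (simp add: a_def eval_nat_numeral mult_ac)
  hence "a = f\<^sup>2 * (f * g) * h ^ 4" by (simp only: gh mult_1_right)
  \<comment> \<open>In the odd part \<open>g^4\<close> meets \<open>h^4\<close>, and the denominator
    disappears.\<close>
  also have "\<dots> = f ^ 8 * h ^ 4 + fps_X * (f\<^sup>2 * g\<^sup>2 * (g ^ 4 * h ^ 4))"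
    unfolding fg by (simp add: eval_nat_numeral algebra_simps)
  also have "\<dots> = ((f ^ 4 * h\<^sup>2)\<^sup>2) + fps_X * (f * g)\<^sup>2"
    by (simp add: gh' power_mult_distrib flip: power_mult)
  finally have a: "a = (f ^ 4 * h\<^sup>2)\<^sup>2 + fps_X * (f * g)\<^sup>2" .
  have "F $ (4 * r + 2) = a $ (2 * r + 1)"
    unfolding F by (simp add: bit_fps_square_nth fps_X_def)
  also have "\<dots> = (f * g) $ r"
    by (subst a) (simp add: bit_fps_square_nth)
  finally show ?thesis by (simp add: F_def f_def g_def)
qed

section \<open>The parity criterion and its invariance under multiplication by
  \<open>p^2\<close>\<close>

lemma odd_J10_iff:
  assumes "N mod 4 = 1"
  shows "odd (J10 N) \<longleftrightarrow> (\<exists>s. N = s\<^sup>2) \<noteq> (\<exists>s. N = 5 * s\<^sup>2)"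
proof -
  define r where "r = N div 4"
  have N: "N = 4 * r + 1" using assms by (simp add: r_def) presburger
  have bit_of_int: "(of_int z :: bit) = of_bool (odd z)" for z
    by (cases z rule: int_cases2) (simp_all add: bit_of_nat)
  have "of_bool (odd (J10 N)) = (of_int (j10_F $ (4 * r + 2)) :: bit)"
    \<comment> \<open>The correction term of \<open>J10\<close> sits at index 0 and is avoided
      because \<open>N\<close> is at least 1.\<close>
    by (simp add: J10_def N bit_of_int)
  also have "\<dots> = of_bool ((\<exists>s. N = s\<^sup>2) \<noteq> (\<exists>s. N = 5 * s\<^sup>2))"
    unfolding j10_F_nth_mod_2 theta_fps_quintic[symmetric] quintic_theta_nth N ..
  finally show ?thesis by (simp only: of_bool_eq_iff)
qed

theorem theorem4p3:
  fixes k n p \<delta> :: nat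
  assumes "k > 0" and "prime p" and "p mod 4 = 3" and "p dvd 4 * \<delta> + 3"
  shows "[J10 (p * (4 * p ^ k * n + 4 * \<delta> + 3)) =
          J10 (4 * p ^ (k - 1) * n + (4 * \<delta> + 3) div p)] (mod 2)"
proof -
  define M where "M = 4 * p ^ (k - 1) * n + (4 * \<delta> + 3) div p"
  have p0: "p > 0" using assms(2) by (rule prime_gt_0_nat)
  have "p ^ k = p * p ^ (k - 1)" using assms(1) by (simp add: power_eq_if)
  hence pM: "4 * p ^ k * n + 4 * \<delta> + 3 = p * M"
    using assms(4) by (simp add: M_def algebra_simps)
  have "4 * p ^ k * n + 4 * \<delta> + 3 = 3 + 4 * (p ^ k * n + \<delta>)" by (simp add: algebra_simps)
  hence "p * M = 3 + 4 * (p ^ k * n + \<delta>)" by (simp only: pM)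
  hence "(p * M) mod 4 = 3" by (simp only: mod_mult_self2) simp
  \<comment> \<open>Both \<open>p\<close> and \<open>p * M\<close> are 3 modulo 4, and 3 is
    invertible there; this puts \<open>M\<close>, and with it \<open>p * (p * M)\<close>, in the
    class covered by the criterion.\<close>
  hence "(3 * (M mod 4)) mod 4 = 3" using assms(3) by (metis mod_mult_eq mod_mod_trivial)
  moreover have "M mod 4 \<in> {0, 1, 2, 3}" using mod_less_divisor[of 4 M] by force
  ultimately have M4: "M mod 4 = 1" by auto
  have p2: "(p * (p * M)) mod 4 = 1"
  proof -
    have "(p * (p * M)) mod 4 = ((p mod 4) * ((p * M) mod 4)) mod 4" by (simp add: mod_mult_eq)
    thus ?thesis by (simp add: assms(3) \<open>(p * M) mod 4 = 3\<close>)
  qed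
  have "p \<noteq> 5" using assms(3) by auto
  hence p5: "\<not> p dvd 5" using assms(2) primes_dvd_imp_eq[of p 5] by auto
  \<comment> \<open>Used for \<open>c = 1\<close> and \<open>c = 5\<close>, the two conditions of
    the criterion. Since \<open>p\<close> does not divide \<open>c\<close>, it divides
    \<open>s\<close>, and \<open>p^2\<close> cancels; \<open>p = 5\<close> is excluded by its
    residue modulo 4.\<close>
  have sq: "(\<exists>s. p * (p * M) = c * s\<^sup>2) \<longleftrightarrow> (\<exists>s. M = c * s\<^sup>2)" if c: "\<not> p dvd c" for c
  proof safe
    fix s assume s: "p * (p * M) = c * s\<^sup>2"
    hence "p dvd c * s\<^sup>2" by (metis dvd_triv_left)
    hence "p dvd s" using c assms(2) by (simp add: prime_dvd_mult_iff prime_dvd_power_iff)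
    then obtain t where "s = p * t" by blast
    hence "p\<^sup>2 * M = p\<^sup>2 * (c * t\<^sup>2)" using s by (simp add: power2_eq_square mult_ac)
    hence "M = c * t\<^sup>2" using p0 by simp
    thus "\<exists>s. M = c * s\<^sup>2" by blast
  next
    fix s assume "M = c * s\<^sup>2"
    hence "p * (p * (c * s\<^sup>2)) = c * (p * s)\<^sup>2" by (simp add: power2_eq_square mult_ac)
    thus "\<exists>t. p * (p * (c * s\<^sup>2)) = c * t\<^sup>2" by blast
  qed
  have "\<not> p dvd 1" using assms(2) by (simp add: prime_nat_iff)
  from sq[OF this] sq[OF p5] have "odd (J10 (p * (p * M))) \<longleftrightarrow> odd (J10 M)"
    by (simp add: odd_J10_iff[OF p2] odd_J10_iff[OF M4])
  hence "[J10 (p * (p * M)) = J10 M] (mod 2)"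
    by (simp add: cong_iff_dvd_diff)
  thus ?thesis by (simp only: pM M_def)
qed

end
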